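(* Let $k\ge 1$ and let $T_k=\{1,2\}^k$ be the $k$-dimensional binary contingency table formed by the ranges of the variables $V_1,\ldots,V_k$. Let $M=\{0,1\}^k$, and for $m\in M$ let $|m|=m_1+\cdots+m_k$ and $\mathcal V_m=\{V_i : m_i=1\}$. For a distribution $p=(p(t):t\in T_k)$ let $p_m$ denote the marginal distribution of the variables in $\mathcal V_m$, a distribution on the $|m|$-dimensional binary table. Let $f$ be either $LOR$ or $DI$. Then the distribution $p$ on $T_k$ can be reconstructed from the $2^k$ values $f_{|m|}(p_m)$, $m\in M$; that is, the map $$p\longmapsto \bigl(f_{|m|}(p_m)\bigr)_{m\in M}$$ is injective on the set of all distributions on $T_k$ (so it is invertible on its image), both when $f=LOR$ and when $f=DI$.
   Context: A distribution on $T_k=\{1,2\}^k$ is any family $(p(t):t\in T_k)$ of strictly positive real numbers (not necessarily summing to $1$). For $j\ge 1$, let $T_{je}$ be the set of cells $t\in\{1,2\}^j$ with an even number of coordinates equal to $2$, and $T_{jo}$ the set of cells with an odd number of coordinates equal to $2$. For $j\ge 1$ and a distribution $r$ on $\{1,2\}^j$, define $$LOR_j(r)=\sum_{t\in T_{je}}\log r(t)-\sum_{t\in T_{jo}}\log r(t),\qquad DI_j(r)=\sum_{t\in T_{je}} r(t)-\sum_{t\in T_{jo}} r(t).$$ For a nonzero $m\in\{0,1\}^k$, the marginal distribution $p_m$ is defined on $\{1,2\}^{\{i:m_i=1\}}$ by $p_m(s)=\sum p(t)$, the sum being over all $t\in T_k$ with $t_i=s_i$ for every $i$ with $m_i=1$.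 For $m=0$ (the empty set of variables) the zero-dimensional parameters are defined by convention from the whole table: $LOR_0$ is $\log\prod_{t\in T_k}p(t)$ and $DI_0$ is $\sum_{t\in T_k}p(t)$. *)

theory Defs
  imports Complex_Main "HOL-Library.FuncSet"
begin

text \<open>
  A binary table is indexed by a finite set \<open>I\<close> of variables rather than by its dimension, since
  the marginals live on \<open>{1,2}\<close> to the power \<open>{i. m i = 1}\<close>; its dimension is \<open>card I\<close>.
  Functions on a set are taken to be extensional, so that equality of functions is equality on
  their domain.
\<close>

definition cells :: "nat set \<Rightarrow> (nat \<Rightarrow> nat) set" where
  "cells I = (I \<rightarrow>\<^sub>E {1, 2})"

definition even_cells :: "nat set \<Rightarrow> (nat \<Rightarrow> nat) set" where
  "even_cells I = {t \<in> cells I. even (card {i \<in> I. t i = 2})}"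

definition odd_cells :: "nat set \<Rightarrow> (nat \<Rightarrow> nat) set" where
  "odd_cells I = {t \<in> cells I. odd (card {i \<in> I. t i = 2})}"

definition distributions :: "nat set \<Rightarrow> ((nat \<Rightarrow> nat) \<Rightarrow> real) set" where
  "distributions I = (cells I \<rightarrow>\<^sub>E {0<..})"

text \<open>The next two are meant for nonempty \<open>I\<close> only; the zero-dimensional parameters are set by
  convention in \<open>LOR_param\<close> and \<open>DI_param\<close> below.\<close>

definition LOR :: "nat set \<Rightarrow> ((nat \<Rightarrow> nat) \<Rightarrow> real) \<Rightarrow> real" where
  "LOR I r = (\<Sum>t\<in>even_cells I. ln (r t)) - (\<Sum>t\<in>odd_cells I. ln (r t))"

definition DI :: "nat set \<Rightarrow> ((nat \<Rightarrow> nat) \<Rightarrow> real) \<Rightarrow> real" where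
  "DI I r = (\<Sum>t\<in>even_cells I. r t) - (\<Sum>t\<in>odd_cells I. r t)"

definition indices :: "nat \<Rightarrow> (nat \<Rightarrow> nat) set" where
  "indices k = ({1..k} \<rightarrow>\<^sub>E {0, 1})"

definition vars :: "nat \<Rightarrow> (nat \<Rightarrow> nat) \<Rightarrow> nat set" where
  "vars k m = {i \<in> {1..k}. m i = 1}"

definition marginal :: "nat \<Rightarrow> ((nat \<Rightarrow> nat) \<Rightarrow> real) \<Rightarrow> (nat \<Rightarrow> nat) \<Rightarrow> ((nat \<Rightarrow> nat) \<Rightarrow> real)" where
  "marginal k p m =
     (\<lambda>s\<in>cells (vars k m). \<Sum>t | t \<in> cells {1..k} \<and> (\<forall>i\<in>vars k m. t i = s i). p t)"

text \<open>For the empty set of variables the \<open>LOR\<close> parameter is the logarithm of the product of all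
  cells, which is not \<open>LOR {}\<close> of the empty marginal (that would be the logarithm of their sum).\<close>

definition LOR_param :: "nat \<Rightarrow> ((nat \<Rightarrow> nat) \<Rightarrow> real) \<Rightarrow> (nat \<Rightarrow> nat) \<Rightarrow> real" where
  "LOR_param k p m =
     (if vars k m = {} then ln (\<Prod>t\<in>cells {1..k}. p t) else LOR (vars k m) (marginal k p m))"

definition DI_param :: "nat \<Rightarrow> ((nat \<Rightarrow> nat) \<Rightarrow> real) \<Rightarrow> (nat \<Rightarrow> nat) \<Rightarrow> real" where
  "DI_param k p m =
     (if vars k m = {} then (\<Sum>t\<in>cells {1..k}. p t) else DI (vars k m) (marginal k p m))"

end

theory Submission
  imports Defs
begin

text \<open>
  The marginals of \<open>p\<close> are recovered one set of variables at a time, by induction along inclusion.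
  If two tables have the same marginals over every proper subset of \<open>I\<close>, then their marginals
  over \<open>I\<close> differ by a function \<open>d\<close> that cancels along every coordinate, so \<open>d\<close> is a constant
  times the parity sign of the cell (lemma \<open>alternating_imp_multiple_of_parity\<close>).  Both \<open>LOR\<close> and
  \<open>DI\<close> are parity-signed sums of a strictly increasing function \<open>g\<close> of the cell values, with
  \<open>g = ln\<close> and \<open>g\<close> the identity respectively.  Hence adding a nonzero multiple of the sign
  moves every term of the signed sum in the same direction; if the signed sums agree, then
  \<open>d = 0\<close> (lemma \<open>eq_if_contrast_eq\<close>).  So the parameters for nonempty sets
  determine the whole table among all tables with the same total
  (lemma \<open>determined_by_total_and_contrasts\<close>).

  For \<open>DI\<close> the total is the zero-dimensional parameter.  For \<open>LOR\<close> it is not known at first, but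
  the parameters for nonempty sets do not change when a table is multiplied by a constant, because
  the parity signs sum to zero.  Scaling \<open>p\<close> to the total of \<open>q\<close> therefore gives \<open>q = a p\<close>, and
  equality of the products of all cells forces \<open>a = 1\<close>.
\<close>

section \<open>Parity signs and contrasts\<close>

definition parity_sign :: "nat set \<Rightarrow> (nat \<Rightarrow> nat) \<Rightarrow> real" where
  "parity_sign I t = (-1) ^ card {i \<in> I. t i = 2}"

definition contrast :: "nat set \<Rightarrow> ((nat \<Rightarrow> nat) \<Rightarrow> real) \<Rightarrow> real" where
  "contrast I h = (\<Sum>t\<in>cells I. parity_sign I t * h t)"

lemma finite_cells: "finite I \<Longrightarrow> finite (cells I)"
  by (simp add: cells_def finite_PiE)

lemma even_minus_odd_eq_contrast:
  assumes "finite I"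
  shows "(\<Sum>t\<in>even_cells I. h t) - (\<Sum>t\<in>odd_cells I. h t) = contrast I h"
proof -
  have split: "cells I = even_cells I \<union> odd_cells I" "even_cells I \<inter> odd_cells I = {}"
    by (auto simp: even_cells_def odd_cells_def)
  have fin: "finite (even_cells I)" "finite (odd_cells I)"
    using finite_cells[OF assms] by (auto simp: even_cells_def odd_cells_def)
  have "contrast I h = (\<Sum>t\<in>even_cells I. parity_sign I t * h t) + (\<Sum>t\<in>odd_cells I. parity_sign I t * h t)"
    unfolding contrast_def split(1) using fin split(2) by (rule sum.union_disjoint)
  also have "(\<Sum>t\<in>even_cells I. parity_sign I t * h t) = (\<Sum>t\<in>even_cells I. h t)"
    by (rule sum.cong) (auto simp: even_cells_def parity_sign_def)
  also have "(\<Sum>t\<in>odd_cells I. parity_sign I t * h t) = - (\<Sum>t\<in>odd_cells I. h t)"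
    unfolding sum_negf[symmetric] by (rule sum.cong) (auto simp: odd_cells_def parity_sign_def)
  finally show ?thesis by simp
qed

lemma cells_upd: "s \<in> cells I \<Longrightarrow> i \<in> I \<Longrightarrow> x \<in> {1, 2} \<Longrightarrow> s(i := x) \<in> cells I"
  by (auto simp: cells_def PiE_iff extensional_def)

lemma parity_sign_upd_2:
  assumes "finite I" "i \<in> I"
  shows "parity_sign I (s(i := 2)) = - parity_sign I (s(i := 1))"
proof -
  have "{j \<in> I. (s(i := 2)) j = 2} = insert i {j \<in> I. (s(i := 1)) j = 2}"
    using assms(2) by auto
  then show ?thesis
    using assms(1) by (simp add: parity_sign_def)
qed

text \<open>Expanding a product over the coordinates of the factors \<open>1 + (-1)\<close> lists all parity signs.\<close>

lemma sum_parity_sign_eq_0: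
  assumes "finite I" "I \<noteq> {}"
  shows "(\<Sum>t\<in>cells I. parity_sign I t) = 0"
proof -
  have "parity_sign I t = (\<Prod>i\<in>I. if t i = 2 then -1 else 1)" for t
    using assms(1) by (simp add: parity_sign_def prod.If_cases Int_def)
  then have "(\<Sum>t\<in>cells I. parity_sign I t) = (\<Prod>i\<in>I. \<Sum>x\<in>{1, 2::nat}. if x = 2 then -1 else 1)"
    using assms(1) unfolding cells_def by (subst prod_sum_PiE) auto
  also have "\<dots> = 0"
    using assms by (simp add: card_gt_0_iff)
  finally show ?thesis .
qed

text \<open>Changing a single coordinate flips both \<open>d\<close> and the parity sign, and every cell is reached from
  the all-ones cell by such changes.\<close>

lemma alternating_imp_multiple_of_parity:
  assumes "finite I"
    and alt: "\<And>i s. i \<in> I \<Longrightarrow> s \<in> cells I \<Longrightarrow> d (s(i := 1)) + d (s(i := 2)) = 0"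
    and "s \<in> cells I"
  shows "d s = d (\<lambda>i\<in>I. 1) * parity_sign I s"
  using \<open>s \<in> cells I\<close>
proof (induction "card {i \<in> I. s i = 2}" arbitrary: s)
  case 0
  then have "\<forall>i\<in>I. s i \<noteq> 2"
    using \<open>finite I\<close> by auto
  with 0 have "s = (\<lambda>i\<in>I. 1)"
    by (auto simp: cells_def PiE_iff extensional_def fun_eq_iff)
  with 0 show ?case
    by (simp add: parity_sign_def)
next
  case (Suc n)
  have "{i \<in> I. s i = 2} \<noteq> {}"
    using Suc.hyps(2) by (intro notI) simp
  then obtain i where i: "i \<in> I" "s i = 2"
    by blast
  define s' where "s' = s(i := 1)"
  have s: "s'(i := 2) = s" "s'(i := 1) = s'" "s' \<in> cells I"
    using i Suc.prems by (auto simp: s'_def intro!: cells_upd)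
  have "{j \<in> I. s j = 2} = insert i {j \<in> I. s' j = 2}" "i \<notin> {j \<in> I. s' j = 2}"
    using i by (auto simp: s'_def)
  then have "card {j \<in> I. s' j = 2} = n"
    using Suc.hyps(2) \<open>finite I\<close> by simp
  then have "d s' = d (\<lambda>i\<in>I. 1) * parity_sign I s'"
    using Suc.hyps(1) s(3) by blast
  moreover have "d s = - d s'"
    using alt[OF i(1) s(3)] s by simp
  moreover have "parity_sign I s = - parity_sign I s'"
    using parity_sign_upd_2[OF \<open>finite I\<close> i(1), of s'] s by simp
  ultimately show ?case by simp
qed

text \<open>The products of the differences of values and of \<open>g\<close>-values are nonnegative by monotonicity,
  while their sum is a multiple of the difference of the two contrasts.  So all of them vanish.\<close>

lemma eq_if_contrast_eq:
  assumes "finite I" and mono: "strict_mono_on {0<..} g"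
    and pos: "\<And>s. s \<in> cells I \<Longrightarrow> u s > 0" "\<And>s. s \<in> cells I \<Longrightarrow> v s > 0"
    and diff: "\<And>s. s \<in> cells I \<Longrightarrow> u s - v s = c * parity_sign I s"
    and eq: "contrast I (\<lambda>s. g (u s)) = contrast I (\<lambda>s. g (v s))"
    and s: "s \<in> cells I"
  shows "u s = v s"
proof -
  have neq: "(u t - v t) * (g (u t) - g (v t)) > 0" if "t \<in> cells I" "u t \<noteq> v t" for t
    using that pos[OF that(1)] strict_mono_onD[OF mono, of "u t" "v t"]
      strict_mono_onD[OF mono, of "v t" "u t"]
    by (cases "u t < v t") (auto simp: mult_neg_neg)
  then have nonneg: "(u t - v t) * (g (u t) - g (v t)) \<ge> 0" if "t \<in> cells I" for t
    using that by (cases "u t = v t") (auto intro: less_imp_le)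
  have "(\<Sum>t\<in>cells I. (u t - v t) * (g (u t) - g (v t)))
      = c * (contrast I (\<lambda>s. g (u s)) - contrast I (\<lambda>s. g (v s)))"
    unfolding contrast_def sum_subtractf[symmetric] sum_distrib_left
    by (rule sum.cong) (auto simp: diff algebra_simps)
  then have "(\<Sum>t\<in>cells I. (u t - v t) * (g (u t) - g (v t))) = 0"
    using eq by simp
  then have "\<forall>t\<in>cells I. (u t - v t) * (g (u t) - g (v t)) = 0"
    by (subst (asm) sum_nonneg_eq_0_iff) (use finite_cells[OF \<open>finite I\<close>] nonneg in blast)+
  then show ?thesis
    using neq[OF s] s by (metis less_irrefl)
qed

section \<open>Marginal sums\<close>

definition marginal_sum ::
    "nat set \<Rightarrow> nat set \<Rightarrow> ((nat \<Rightarrow> nat) \<Rightarrow> real) \<Rightarrow> (nat \<Rightarrow> nat) \<Rightarrow> real" where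
  "marginal_sum J I p s = (\<Sum>t | t \<in> cells J \<and> (\<forall>i\<in>I. t i = s i). p t)"

lemma marginal_sum_cong:
  "(\<And>i. i \<in> I \<Longrightarrow> s i = s' i) \<Longrightarrow> marginal_sum J I p s = marginal_sum J I p s'"
  unfolding marginal_sum_def by (rule sum.cong) auto

lemma marginal_sum_empty: "marginal_sum J {} p s = (\<Sum>t\<in>cells J. p t)"
  by (simp add: marginal_sum_def)

lemma marginal_sum_self:
  assumes "s \<in> cells J"
  shows "marginal_sum J J p s = p s"
proof -
  have "{t. t \<in> cells J \<and> (\<forall>i\<in>J. t i = s i)} = {s}"
    using assms by (auto simp: cells_def intro: PiE_ext)
  then show ?thesis
    by (simp add: marginal_sum_def)
qed

lemma marginal_sum_scale: "marginal_sum J I (\<lambda>t. a * p t) s = a * marginal_sum J I p s"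
  by (simp add: marginal_sum_def sum_distrib_left)

lemma marginal_sum_pos:
  assumes "finite J" "I \<subseteq> J" "s \<in> cells I" and pos: "\<And>t. t \<in> cells J \<Longrightarrow> p t > 0"
  shows "marginal_sum J I p s > 0"
  unfolding marginal_sum_def
proof (rule sum_pos)
  show "finite {t. t \<in> cells J \<and> (\<forall>i\<in>I. t i = s i)}"
    using finite_cells[OF assms(1)] by simp
  \<comment> \<open>Extending \<open>s\<close> by ones shows that the sum has at least one term.\<close>
  have "(\<lambda>i\<in>J. if i \<in> I then s i else 1) \<in> {t. t \<in> cells J \<and> (\<forall>i\<in>I. t i = s i)}"
    using assms(2,3) by (auto simp: cells_def PiE_iff)
  then show "{t. t \<in> cells J \<and> (\<forall>i\<in>I. t i = s i)} \<noteq> {}"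
    by blast
qed (use pos in auto)

lemma marginal_sum_remove:
  assumes "finite J" "I \<subseteq> J" "i \<in> I"
  shows "marginal_sum J (I - {i}) p s
       = marginal_sum J I p (s(i := 1)) + marginal_sum J I p (s(i := 2))"
proof -
  let ?A = "\<lambda>x. {t. t \<in> cells J \<and> (\<forall>j\<in>I. t j = (s(i := x)) j)}"
  have "t i = 1 \<or> t i = 2" if "t \<in> cells J" for t
    using that assms by (auto simp: cells_def PiE_iff)
  then have "{t. t \<in> cells J \<and> (\<forall>j\<in>I - {i}. t j = s j)} = ?A 1 \<union> ?A 2"
    using assms(3) by auto
  moreover have "?A 1 \<inter> ?A 2 = {}"
    using assms(3) by auto
  moreover have "finite (?A x)" for x
    using finite_cells[OF assms(1)] by simp
  ultimately show ?thesis
    unfolding marginal_sum_def by (simp add: sum.union_disjoint)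
qed

section \<open>Reconstruction by induction on the set of variables\<close>

text \<open>The empty marginal is the total.  For nonempty \<open>I\<close>, adding the two cells of the marginal
  over \<open>I\<close> that differ only at \<open>i\<close> gives a cell of the marginal over \<open>I - {i}\<close>, where the two
  tables already agree.  This makes the difference over \<open>I\<close> alternating, and the contrast over
  \<open>I\<close> removes the remaining degree of freedom.\<close>

lemma marginal_sum_eq_if_contrasts_eq:
  assumes "finite J" and mono: "strict_mono_on {0<..} g"
    and pos: "\<And>t. t \<in> cells J \<Longrightarrow> p t > 0" "\<And>t. t \<in> cells J \<Longrightarrow> q t > 0"
    and total: "(\<Sum>t\<in>cells J. p t) = (\<Sum>t\<in>cells J. q t)"
    and contrasts: "\<And>I. I \<subseteq> J \<Longrightarrow> I \<noteq> {} \<Longrightarrow>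
      contrast I (\<lambda>s. g (marginal_sum J I p s)) = contrast I (\<lambda>s. g (marginal_sum J I q s))"
    and "I \<subseteq> J" "s \<in> cells I"
  shows "marginal_sum J I p s = marginal_sum J I q s"
proof -
  have "finite I"
    using assms(1) \<open>I \<subseteq> J\<close> by (rule finite_subset[rotated])
  then show ?thesis
    using \<open>I \<subseteq> J\<close> \<open>s \<in> cells I\<close>
  proof (induction I arbitrary: s rule: finite_psubset_induct)
    case (psubset I)
    show ?case
    proof (cases "I = {}")
      case True
      then show ?thesis
        using total by (simp add: marginal_sum_empty)
    next
      case False
      define d where "d = (\<lambda>t. marginal_sum J I p t - marginal_sum J I q t)"
      have alt: "d (t(i := 1)) + d (t(i := 2)) = 0" if "i \<in> I" "t \<in> cells I" for i t
      proof -
        \<comment> \<open>The induction hypothesis speaks of extensional functions on \<open>I - {i}\<close>, whereas \<open>t\<close> is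
          defined at \<open>i\<close> as well; the marginal sum over \<open>I - {i}\<close> does not see that value.\<close>
        have "restrict t (I - {i}) \<in> cells (I - {i})"
          using that by (auto simp: cells_def PiE_iff)
        then have "marginal_sum J (I - {i}) p (restrict t (I - {i}))
            = marginal_sum J (I - {i}) q (restrict t (I - {i}))"
          using that psubset.prems by (intro psubset.IH) blast+
        then have "marginal_sum J (I - {i}) p t = marginal_sum J (I - {i}) q t"
          using marginal_sum_cong[of "I - {i}" "restrict t (I - {i})" t] by simp
        then show ?thesis
          using marginal_sum_remove[OF assms(1) psubset.prems(1) that(1)] by (simp add: d_def)
      qed
      have diff: "marginal_sum J I p t - marginal_sum J I q t = d (\<lambda>i\<in>I. 1) * parity_sign I t"
        if "t \<in> cells I" for t
        using alternating_imp_multiple_of_parity[of I d, OF psubset.hyps alt that] by (simp add: d_def)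
      have "marginal_sum J I p t > 0" "marginal_sum J I q t > 0" if "t \<in> cells I" for t
        using assms(1) psubset.prems(1) that pos by (simp_all add: marginal_sum_pos)
      from eq_if_contrast_eq[OF psubset.hyps mono this diff
          contrasts[OF psubset.prems(1) False] psubset.prems(2)]
      show ?thesis .
    qed
  qed
qed

lemma determined_by_total_and_contrasts:
  assumes "finite J" "strict_mono_on {0<..} g"
    and "\<And>t. t \<in> cells J \<Longrightarrow> p t > 0" "\<And>t. t \<in> cells J \<Longrightarrow> q t > 0"
    and "(\<Sum>t\<in>cells J. p t) = (\<Sum>t\<in>cells J. q t)"
    and "\<And>I. I \<subseteq> J \<Longrightarrow> I \<noteq> {} \<Longrightarrow>
      contrast I (\<lambda>s. g (marginal_sum J I p s)) = contrast I (\<lambda>s. g (marginal_sum J I q s))"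
    and "t \<in> cells J"
  shows "p t = q t"
proof -
  have "marginal_sum J J p t = marginal_sum J J q t"
    by (rule marginal_sum_eq_if_contrasts_eq[of J g p q J t]) (fact assms order_refl)+
  then show ?thesis
    using assms(7) by (simp add: marginal_sum_self)
qed

section \<open>The log odds ratio and the difference parameters\<close>

text \<open>Scaling adds the constant \<open>ln a\<close> to every logarithm, and constants have contrast zero.\<close>

lemma contrast_ln_scale:
  assumes "finite I" "I \<noteq> {}" "a > 0" "\<And>s. s \<in> cells I \<Longrightarrow> r s > 0"
  shows "contrast I (\<lambda>s. ln (a * r s)) = contrast I (\<lambda>s. ln (r s))"
proof -
  have "contrast I (\<lambda>s. ln (a * r s))
      = (\<Sum>s\<in>cells I. ln a * parity_sign I s + parity_sign I s * ln (r s))"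
    unfolding contrast_def using assms(3,4)
    by (intro sum.cong) (simp_all add: ln_mult_pos algebra_simps)
  also have "\<dots> = ln a * (\<Sum>s\<in>cells I. parity_sign I s) + contrast I (\<lambda>s. ln (r s))"
    by (simp add: contrast_def sum.distrib sum_distrib_left)
  finally show ?thesis
    using sum_parity_sign_eq_0[OF assms(1,2)] by simp
qed

text \<open>This turns a family of parameters indexed by 0-1 vectors into one indexed by sets of
  variables, over which the induction runs.\<close>

lemma subset_eq_vars:
  assumes "I \<subseteq> {1..k}"
  obtains m where "m \<in> indices k" "vars k m = I"
proof
  let ?m = "\<lambda>i\<in>{1..k}. if i \<in> I then 1 else 0 :: nat"
  show "?m \<in> indices k"
    by (auto simp: indices_def)
  show "vars k ?m = I"
    using assms by (auto simp: vars_def)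
qed

lemma LOR_param_nonempty:
  assumes "vars k m \<noteq> {}"
  shows "LOR_param k p m
       = contrast (vars k m) (\<lambda>s. ln (marginal_sum {1..k} (vars k m) p s))"
proof -
  have "finite (vars k m)"
    by (simp add: vars_def)
  then show ?thesis
    using assms unfolding LOR_param_def LOR_def
    by (simp add: even_minus_odd_eq_contrast)
      (simp add: contrast_def marginal_def marginal_sum_def)
qed

lemma DI_param_nonempty:
  assumes "vars k m \<noteq> {}"
  shows "DI_param k p m = contrast (vars k m) (marginal_sum {1..k} (vars k m) p)"
proof -
  have "finite (vars k m)"
    by (simp add: vars_def)
  then show ?thesis
    using assms unfolding DI_param_def DI_def
    by (simp add: even_minus_odd_eq_contrast)
      (simp add: contrast_def marginal_def marginal_sum_def)
qed

lemma distributions_pos: "p \<in> distributions I \<Longrightarrow> t \<in> cells I \<Longrightarrow> p t > 0"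
  by (auto simp: distributions_def)

lemma distributions_eqI:
  "p \<in> distributions I \<Longrightarrow> q \<in> distributions I \<Longrightarrow> (\<And>t. t \<in> cells I \<Longrightarrow> p t = q t) \<Longrightarrow> p = q"
  unfolding distributions_def by (rule PiE_ext)

lemma DI_param_inj:
  assumes p: "p \<in> distributions {1..k}" and q: "q \<in> distributions {1..k}"
    and eq: "\<And>m. m \<in> indices k \<Longrightarrow> DI_param k p m = DI_param k q m"
  shows "p = q"
proof (rule distributions_eqI[OF p q])
  fix t assume t: "t \<in> cells {1..k}"
  obtain m0 where "m0 \<in> indices k" "vars k m0 = {}"
    using subset_eq_vars[of "{}" k] by blast
  then have total: "(\<Sum>t\<in>cells {1..k}. p t) = (\<Sum>t\<in>cells {1..k}. q t)"
    using eq[of m0] by (simp add: DI_param_def)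
  have contrasts: "contrast I (\<lambda>s. marginal_sum {1..k} I p s)
      = contrast I (\<lambda>s. marginal_sum {1..k} I q s)" if "I \<subseteq> {1..k}" "I \<noteq> {}" for I
    using subset_eq_vars[OF that(1)] eq that(2) by (metis DI_param_nonempty)
  have mono: "strict_mono_on {0<..} (\<lambda>x::real. x)"
    by (simp add: strict_mono_on_def)
  show "p t = q t"
    by (rule determined_by_total_and_contrasts[of "{1..k}" "\<lambda>x. x" p q t])
      (fact finite_atLeastAtMost mono distributions_pos[OF p] distributions_pos[OF q]
        total contrasts t)+
qed

lemma LOR_param_inj:
  assumes p: "p \<in> distributions {1..k}" and q: "q \<in> distributions {1..k}"
    and eq: "\<And>m. m \<in> indices k \<Longrightarrow> LOR_param k p m = LOR_param k q m"
  shows "p = q"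
proof -
  let ?C = "cells {1..k}"
  have fin: "finite ?C" and ne: "?C \<noteq> {}"
    by (simp_all add: finite_cells) (simp add: cells_def PiE_eq_empty_iff)
  note pos = distributions_pos[OF p] distributions_pos[OF q]
  have sums: "sum p ?C > 0" "sum q ?C > 0"
    using fin ne pos by (auto intro: sum_pos)
  \<comment> \<open>The factor that gives \<open>p\<close> the same total as \<open>q\<close>.\<close>
  define a where "a = sum q ?C / sum p ?C"
  have "a > 0"
    using sums by (simp add: a_def)
  have total: "(\<Sum>t\<in>?C. a * p t) = (\<Sum>t\<in>?C. q t)"
    unfolding sum_distrib_left[symmetric] using sums by (simp add: a_def)
  have contrasts: "contrast I (\<lambda>s. ln (marginal_sum {1..k} I (\<lambda>t. a * p t) s))
      = contrast I (\<lambda>s. ln (marginal_sum {1..k} I q s))" if I: "I \<subseteq> {1..k}" "I \<noteq> {}" for I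
  proof -
    have "finite I"
      using I(1) by (rule finite_subset) simp
    then have "contrast I (\<lambda>s. ln (marginal_sum {1..k} I (\<lambda>t. a * p t) s))
        = contrast I (\<lambda>s. ln (marginal_sum {1..k} I p s))"
      unfolding marginal_sum_scale using I \<open>a > 0\<close> pos
      by (intro contrast_ln_scale) (auto intro: marginal_sum_pos)
    also have "\<dots> = contrast I (\<lambda>s. ln (marginal_sum {1..k} I q s))"
      using subset_eq_vars[OF I(1)] eq I(2) by (metis LOR_param_nonempty)
    finally show ?thesis .
  qed
  have mono: "strict_mono_on {0<..} (ln :: real \<Rightarrow> real)"
    by (simp add: strict_mono_on_def)
  have pos': "a * p t > 0" if "t \<in> ?C" for t
    using that pos(1) \<open>a > 0\<close> by simp
  have q_eq: "a * p t = q t" if "t \<in> ?C" for t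
    by (rule determined_by_total_and_contrasts[of "{1..k}" ln "\<lambda>t. a * p t" q t])
      (fact finite_atLeastAtMost mono pos' pos(2) total contrasts that)+
  obtain m0 where "m0 \<in> indices k" "vars k m0 = {}"
    using subset_eq_vars[of "{}" k] by blast
  then have "ln (\<Prod>t\<in>?C. p t) = ln (\<Prod>t\<in>?C. q t)"
    using eq[of m0] by (simp add: LOR_param_def)
  moreover have prods: "(\<Prod>t\<in>?C. p t) > 0" "(\<Prod>t\<in>?C. q t) > 0"
    using pos by (auto intro: prod_pos)
  ultimately have "(\<Prod>t\<in>?C. p t) = (\<Prod>t\<in>?C. q t)"
    by simp
  also have "\<dots> = a ^ card ?C * (\<Prod>t\<in>?C. p t)"
    by (simp add: q_eq[symmetric] prod.distrib)
  finally have "a ^ card ?C = 1"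
    using prods by simp
  then have "a = 1"
    using \<open>a > 0\<close> fin ne power_eq_imp_eq_base[of a "card ?C" 1] by (simp add: card_gt_0_iff)
  with q_eq show ?thesis
    by (intro distributions_eqI[OF p q]) simp
qed

theorem theorem1:
  fixes k :: nat
  assumes "k \<ge> 1"
  shows "inj_on (\<lambda>p. \<lambda>m\<in>indices k. LOR_param k p m) (distributions {1..k})
       \<and> inj_on (\<lambda>p. \<lambda>m\<in>indices k. DI_param k p m) (distributions {1..k})"
proof (intro conjI inj_onI)
  fix p q
  assume "p \<in> distributions {1..k}" "q \<in> distributions {1..k}"
    "(\<lambda>m\<in>indices k. LOR_param k p m) = (\<lambda>m\<in>indices k. LOR_param k q m)"
  then show "p = q"
    by (metis (no_types, lifting) LOR_param_inj restrict_apply')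
next
  fix p q
  assume "p \<in> distributions {1..k}" "q \<in> distributions {1..k}"
    "(\<lambda>m\<in>indices k. DI_param k p m) = (\<lambda>m\<in>indices k. DI_param k q m)"
  then show "p = q"
    by (metis (no_types, lifting) DI_param_inj restrict_apply')
qed

end
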